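(* Let $X$ be a Gaussian random variable on $\mathbb{R}^n$ with density $p_X(x)=\mathcal{N}(x;\mathfrak{m},\mathfrak{S})$, with mean $\mathfrak{m}\in\mathbb{R}^n$ and symmetric positive definite covariance $\mathfrak{S}\in\mathbb{R}^{n\times n}$. Let $\mathbf{X}=[x_1,\dots,x_N]$ be an ensemble of $N$ samples from $X$, and let $S_1,\dots,S_N\in\mathbb{R}^{n\times n}$ be symmetric positive definite matrices. For each $i=1,\dots,N$ let the local information variable $\mathcal{L}$ have conditional likelihood at $x_i$ given by $$p_{\mathcal{L}\mid X=x}(x_i)=\frac{C}{|S_i|^{1/2}}\,e^{-\frac12 (x_i-x)^T S_i^{-1}(x_i-x)},\qquad x\in\mathbb{R}^n,$$ where $C>0$ is a normalizing constant, and let $\operatorname{Cov}(X\mid\mathcal{L}=x_i)$ denote the covariance matrix of the conditional distribution $p_{X\mid\mathcal{L}=x_i}$. Define $$\widetilde{\Sigma}_i=\operatorname{Cov}(X\mid\mathcal{L}=x_i)\,\bigl[S_i-\operatorname{Cov}(X\mid\mathcal{L}=x_i)\bigr]^{-1}S_i,\qquad \widehat{\Sigma}_i=\beta_N^2\,\widetilde{\Sigma}_i,\qquad i=1,\dots,N.$$ Then, for any choice of $\{S_i\}_{i=1}^N$, the ensemble-localized density estimate $$\widehat{p}_X(x)=\frac1N\sum_{i=1}^N K_{\widehat{\Sigma}_i}(x-x_i)$$ is exactly equal to the canonical kernel density estimate $$\frac1N\sum_{i=1}^N K_{\beta_N^2\mathfrak{S}}(x-x_i)$$ for all $x\in\m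athbb{R}^n$.
   Context: $\mathcal{N}(x;\mathfrak{m},\mathfrak{S})$ denotes the Gaussian density with mean $\mathfrak{m}$ and covariance $\mathfrak{S}$ evaluated at $x$, and $|\cdot|$ of a matrix in the density formulas denotes its determinant. Gaussian kernel: for a symmetric positive definite matrix $\Sigma\in\mathbb{R}^{n\times n}$, $K_\Sigma(x)=(2\pi)^{-n/2}|\Sigma|^{-1/2}e^{-\frac12 x^T\Sigma^{-1}x}$. Bandwidth factor: $\beta_N^2=\left(\frac{4}{N(n+2)}\right)^{\frac{2}{n+4}}$. Canonical kernel density estimate (CKDE): the kernel density estimate $\frac1N\sum_{i=1}^N K_{\Sigma_i}(x-x_i)$ with the Gaussian kernel and $\Sigma_i=\beta_N^2\mathfrak{S}$ for all $i$, where $\mathfrak{S}$ is the (global) covariance of $X$. Local information variable: $\mathcal{L}$ is a synthetic random variable used to localize around the point $x_i$. A separate choice of the conditional likelihood (with its own matrix $S_i$) is made for each $i$. The conditional distribution of $X$ given $\mathcal{L}=x_i$ is defined by Bayes' rule as the probability density in $x$ satisfying $p_{X\mid\mathcal{L}=x_i}(x)\propto p_{\mathcal{L}\mid X=x}(x_i)\,p_X(x)$. *)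

theory Defs
  imports "HOL-Probability.Probability"
begin

definition spd_matrix :: "real ^ 'n ^ 'n \<Rightarrow> bool" where
  "spd_matrix A \<longleftrightarrow> transpose A = A \<and> (\<forall>x. x \<noteq> 0 \<longrightarrow> x \<bullet> (A *v x) > 0)"

definition gaussian_kernel :: "real ^ 'n ^ 'n \<Rightarrow> real ^ 'n \<Rightarrow> real" where
  "gaussian_kernel \<Sigma> x =
     (2 * pi) powr (- real CARD('n) / 2) * (det \<Sigma>) powr (- 1 / 2) *
     exp (- 1 / 2 * (x \<bullet> (matrix_inv \<Sigma> *v x)))"

definition gaussian_density :: "real ^ 'n \<Rightarrow> real ^ 'n ^ 'n \<Rightarrow> real ^ 'n \<Rightarrow> real" where
  "gaussian_density \<mm> \<SS> x = gaussian_kernel \<SS> (x - \<mm>)"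

definition bandwidth_sq :: "nat \<Rightarrow> nat \<Rightarrow> real" where
  "bandwidth_sq N n = (4 / (real N * (real n + 2))) powr (2 / (real n + 4))"

definition gaussian_kde ::
    "nat \<Rightarrow> (nat \<Rightarrow> real ^ 'n) \<Rightarrow> (nat \<Rightarrow> real ^ 'n ^ 'n) \<Rightarrow> real ^ 'n \<Rightarrow> real" where
  "gaussian_kde N xs \<Sigma> x = 1 / real N * (\<Sum>i=1..N. gaussian_kernel (\<Sigma> i) (x - xs i))"

definition cov_matrix :: "(real ^ 'n) measure \<Rightarrow> real ^ 'n ^ 'n" where
  "cov_matrix \<mu> =
     (\<chi> i j. LINT y|\<mu>. (y $ i - (LINT z|\<mu>. z) $ i) * (y $ j - (LINT z|\<mu>. z) $ j))"

text \<open>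
  Bayes' rule for a fixed observation \<open>l\<close>: \<open>lik x\<close> is the conditional likelihood of \<open>l\<close>
  given \<open>X = x\<close>, and \<open>prior\<close> is the density of \<open>X\<close>. The two lemmas below
  show that this is exactly the probability density proportional to \<open>lik x * prior x\<close>.
\<close>

definition posterior_density ::
    "('a::euclidean_space \<Rightarrow> real) \<Rightarrow> ('a \<Rightarrow> real) \<Rightarrow> 'a \<Rightarrow> real" where
  "posterior_density lik prior x = lik x * prior x / (LINT y|lborel. lik y * prior y)"

lemma posterior_density_unique:
  assumes eq: "\<And>x. q x = c * (lik x * prior x)"
    and total: "(LINT x|lborel. q x) = 1"
  shows "q = posterior_density lik prior"
proof
  fix x
  have "c * (LINT y|lborel. lik y * prior y) = 1"
    using total by (simp add: eq)
  then have "c = 1 / (LINT y|lborel. lik y * prior y)"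
    by (metis mult_zero_right nonzero_eq_divide_eq zero_neq_one)
  then show "q x = posterior_density lik prior x"
    by (simp add: posterior_density_def eq)
qed

lemma posterior_density_is_density:
  assumes "\<And>x. lik x \<ge> 0" "\<And>x. prior x \<ge> 0"
    and "(LINT y|lborel. lik y * prior y) > 0"
  shows "(\<forall>x. posterior_density lik prior x \<ge> 0) \<and> (LINT x|lborel. posterior_density lik prior x) = 1"
  using assms by (auto simp: posterior_density_def)

definition posterior_cov ::
    "(real ^ 'n \<Rightarrow> real) \<Rightarrow> (real ^ 'n \<Rightarrow> real) \<Rightarrow> real ^ 'n ^ 'n" where
  "posterior_cov lik prior =
     cov_matrix (density lborel (\<lambda>x. ennreal (posterior_density lik prior x)))"

end

theory Submission
  imports Defs
begin

text \<open>Completing the square shows that the posterior is Gaussian with precision matrix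
  \<open>Q = \<SS>\<^sup>-\<^sup>1 + S\<^sub>i\<^sup>-\<^sup>1\<close>, whatever \<open>x\<^sub>i\<close> is. Its covariance is \<open>Q\<^sup>-\<^sup>1\<close>, and then \<open>\<Sigma>t i\<close> collapses
  algebraically to \<open>\<SS>\<close>. The covariance of a Gaussian weight is computed without
  diagonalisation: completing the square and translating gives its Laplace transform, whose
  second-order expansion at \<open>0\<close> contains the second moments. Integrability of the weight
  comes for free from the assumption that the prior is the density of a random variable.\<close>

section \<open>Invariance of Lebesgue integrals under translation and reflection\<close>

lemma matrix_vector_mult_borel_measurable [measurable]:
  "(\<lambda>y. (A :: real ^ 'n ^ 'm) *v y) \<in> borel_measurable borel"
  by (intro borel_measurable_continuous_onI continuous_intros)

lemma
  fixes f :: "'a::euclidean_space \<Rightarrow> 'b::{banach, second_countable_topology}"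
  assumes [measurable]: "f \<in> borel_measurable borel"
  shows integrable_lborel_translate: "integrable lborel (\<lambda>y. f (y - c)) \<longleftrightarrow> integrable lborel f"
    and integral_lborel_translate: "(LINT y|lborel. f (y - c)) = (LINT y|lborel. f y)"
proof -
  have *: "distr lborel borel (\<lambda>y. y - c) = (lborel :: 'a measure)"
    using lborel_distr_plus[of "- c"] by (metis (no_types, lifting) ext uminus_add_conv_diff)
  show "integrable lborel (\<lambda>y. f (y - c)) \<longleftrightarrow> integrable lborel f"
    using integrable_distr_eq[of "\<lambda>y. y - c" lborel borel f] by (simp add: *)
  show "(LINT y|lborel. f (y - c)) = (LINT y|lborel. f y)"
    using integral_distr[of "\<lambda>y. y - c" lborel borel f] by (simp add: *)
qed

lemma integral_lborel_odd:
  fixes f :: "'a::euclidean_space \<Rightarrow> 'b::{banach, second_countable_topology}"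
  assumes [measurable]: "f \<in> borel_measurable borel" and odd: "\<And>y. f (- y) = - f y"
  shows "(LINT y|lborel. f y) = 0"
proof -
  \<comment> \<open>Reflection is the affine map with factor -1, whose Jacobian has absolute value
    1.\<close>
  have "distr lborel borel uminus = (lborel :: 'a measure)"
    by (subst lborel_affine[of "- 1" 0]) (auto simp: density_1 one_ennreal_def[symmetric])
  then have "(LINT y|lborel. f y) = (LINT y|lborel. f (- y))"
    using integral_distr[of uminus lborel borel f] by simp
  also have "\<dots> = - (LINT y|lborel. f y)"
    by (simp add: odd)
  finally have "2 *\<^sub>R (LINT y|lborel. f y) = 0"
    by (simp add: scaleR_2 eq_neg_iff_add_eq_0)
  then show ?thesis
    by simp
qed

section \<open>Matrix inverses and positive definiteness\<close>

lemma matrix_inv_left: "invertible (A :: real ^ 'n ^ 'n) \<Longrightarrow> matrix_inv A ** A = mat 1"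
  and matrix_inv_right: "invertible (A :: real ^ 'n ^ 'n) \<Longrightarrow> A ** matrix_inv A = mat 1"
  using someI_ex[of "\<lambda>A'. A ** A' = mat 1 \<and> A' ** A = mat 1"]
  unfolding invertible_def matrix_inv_def by auto

text \<open>For square matrices a right inverse is two-sided, and inverses are unique, so one
  product identity pins down the choice made by \<open>matrix_inv\<close>.\<close>

lemma matrix_inv_eqI:
  fixes A :: "real ^ 'n ^ 'n"
  assumes "A ** B = mat 1"
  shows "matrix_inv A = B"
proof -
  have "invertible A"
    using assms matrix_left_right_inverse invertible_def by blast
  then show ?thesis
    by (metis assms matrix_inv_left matrix_mul_assoc matrix_mul_lid matrix_mul_rid)
qed

lemma matrix_mult_add_rdistrib:
  fixes A B :: "real ^ 'n ^ 'm" and C :: "real ^ 'k ^ 'n"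
  shows "(A + B) ** C = A ** C + B ** C"
  by (simp add: matrix_matrix_mult_def vec_eq_iff distrib_right sum.distrib)

lemma spd_matrix_inner_commute:
  assumes "spd_matrix A"
  shows "x \<bullet> (A *v y) = y \<bullet> (A *v x)"
  using assms by (metis dot_lmul_matrix inner_commute spd_matrix_def vector_transpose_matrix)

lemma spd_matrix_nonneg: "spd_matrix A \<Longrightarrow> 0 \<le> x \<bullet> (A *v x)"
  unfolding spd_matrix_def by (cases "x = 0") (auto intro: less_imp_le)

lemma spd_matrix_invertible:
  assumes "spd_matrix A"
  shows "invertible A"
proof -
  have "x = 0" if "A *v x = 0" for x
    using assms that unfolding spd_matrix_def by (metis inner_zero_right less_irrefl)
  then show ?thesis
    using matrix_left_invertible_ker invertible_left_inverse by blast
qed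

lemma spd_matrix_add: "spd_matrix A \<Longrightarrow> spd_matrix B \<Longrightarrow> spd_matrix (A + B)"
  unfolding spd_matrix_def
  by (auto simp: transpose_def vec_eq_iff matrix_vector_mult_add_rdistrib inner_add_right add_pos_pos)

text \<open>The transpose of the inverse also inverts \<open>A\<close>, which gives symmetry by
  uniqueness. Positivity comes from the substitution \<open>z = matrix_inv A *v x\<close>, under
  which the form becomes that of \<open>A\<close> at a nonzero \<open>z\<close>.\<close>

lemma spd_matrix_inverse:
  assumes "spd_matrix A"
  shows "spd_matrix (matrix_inv A)"
  unfolding spd_matrix_def
proof (intro conjI allI impI)
  note inv = spd_matrix_invertible[OF assms]
  have "A ** transpose (matrix_inv A) = transpose (matrix_inv A ** A)"
    using assms by (simp add: matrix_transpose_mul spd_matrix_def)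
  then have "A ** transpose (matrix_inv A) = mat 1"
    using inv by (simp add: matrix_inv_left)
  then show "transpose (matrix_inv A) = matrix_inv A"
    by (metis matrix_inv_eqI)
  fix x :: "real ^ 'a" assume "x \<noteq> 0"
  have x: "A *v (matrix_inv A *v x) = x"
    using inv by (simp add: matrix_vector_mul_assoc matrix_inv_right)
  with \<open>x \<noteq> 0\<close> have "matrix_inv A *v x \<noteq> 0"
    by auto
  then have "0 < (matrix_inv A *v x) \<bullet> (A *v (matrix_inv A *v x))"
    using assms unfolding spd_matrix_def by blast
  then show "0 < x \<bullet> (matrix_inv A *v x)"
    by (simp add: x inner_commute)
qed

section \<open>Completing the square in the exponent\<close>

lemma complete_square:
  assumes "spd_matrix Q"
  shows "(y - matrix_inv Q *v b) \<bullet> (Q *v (y - matrix_inv Q *v b)) =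
    y \<bullet> (Q *v y) - 2 * (b \<bullet> y) + b \<bullet> (matrix_inv Q *v b)"
proof -
  have 1: "Q *v (matrix_inv Q *v b) = b"
    by (simp add: matrix_vector_mul_assoc matrix_inv_right spd_matrix_invertible[OF assms])
  have 2: "(matrix_inv Q *v b) \<bullet> (Q *v y) = b \<bullet> y"
    using spd_matrix_inner_commute[OF assms, of "matrix_inv Q *v b" y] by (simp add: 1 inner_commute[of _ b])
  show ?thesis
    by (simp add: matrix_vector_mult_diff_distrib inner_diff_left inner_diff_right 1 2 inner_commute[of _ b])
qed

text \<open>The quadratic parts add up and the linear parts only move the centre. Centre and
  constant are merely asserted to exist, since neither affects the covariance in the end.\<close>

lemma gaussian_product_exponent:
  fixes A B :: "real ^ 'n ^ 'n"
  assumes A: "spd_matrix A" and B: "spd_matrix B"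
  obtains \<mu> k where "\<And>y. (y - m) \<bullet> (A *v (y - m)) + (a - y) \<bullet> (B *v (a - y)) =
    (y - \<mu>) \<bullet> ((A + B) *v (y - \<mu>)) + k"
proof
  fix y
  let ?b = "A *v m + B *v a"
  show "(y - m) \<bullet> (A *v (y - m)) + (a - y) \<bullet> (B *v (a - y)) =
      (y - matrix_inv (A + B) *v ?b) \<bullet> ((A + B) *v (y - matrix_inv (A + B) *v ?b)) +
      (m \<bullet> (A *v m) + a \<bullet> (B *v a) - ?b \<bullet> (matrix_inv (A + B) *v ?b))"
    unfolding complete_square[OF spd_matrix_add[OF A B]]
    using spd_matrix_inner_commute[OF A, of m y] spd_matrix_inner_commute[OF B, of a y]
    by (simp add: matrix_vector_mult_diff_distrib inner_diff_left inner_diff_right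
        matrix_vector_mult_add_rdistrib inner_add_left inner_add_right inner_commute[of _ y])
qed

section \<open>Gaussian weights and their Laplace transform\<close>

text \<open>Indexed by the precision matrix, so that multiplying weights adds their matrices; left
  unnormalised, so that no determinant formula for the integral enters.\<close>

definition gaussian_weight :: "real ^ 'n ^ 'n \<Rightarrow> real ^ 'n \<Rightarrow> real" where
  "gaussian_weight Q y = exp (- 1 / 2 * (y \<bullet> (Q *v y)))"

lemma gaussian_weight_measurable [measurable]: "gaussian_weight Q \<in> borel_measurable borel"
  unfolding gaussian_weight_def by measurable

lemma gaussian_weight_pos: "gaussian_weight Q y > 0"
  by (simp add: gaussian_weight_def)

lemma gaussian_weight_uminus [simp]: "gaussian_weight Q (- y) = gaussian_weight Q y"
  by (simp add: gaussian_weight_def linear_neg[OF matrix_vector_mul_linear])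

lemma integrable_gaussian_weight_add:
  assumes "spd_matrix B" and int: "integrable lborel (gaussian_weight A)"
  shows "integrable lborel (gaussian_weight (A + B))"
proof (rule Bochner_Integration.integrable_bound[OF int])
  show "AE y in lborel. norm (gaussian_weight (A + B) y) \<le> norm (gaussian_weight A y)"
    using spd_matrix_nonneg[OF assms(1)]
    by (auto simp: gaussian_weight_def matrix_vector_mult_add_rdistrib inner_add_right)
qed measurable

lemma gaussian_weight_tilt:
  assumes "spd_matrix Q"
  shows "exp (w \<bullet> y) * gaussian_weight Q y =
    exp (w \<bullet> (matrix_inv Q *v w) / 2) * gaussian_weight Q (y - matrix_inv Q *v w)"
  unfolding gaussian_weight_def complete_square[OF assms]
  by (simp add: exp_add[symmetric] field_simps)

text \<open>An exponential tilt of the weight is a constant multiple of a translate of it, so both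
  claims follow from translation invariance.\<close>

lemma
  fixes Q :: "real ^ 'n ^ 'n"
  assumes spd: "spd_matrix Q" and int: "integrable lborel (gaussian_weight Q)"
  shows integrable_gaussian_tilt: "integrable lborel (\<lambda>y. exp (w \<bullet> y) * gaussian_weight Q y)"
    and integral_gaussian_tilt: "(LINT y|lborel. exp (w \<bullet> y) * gaussian_weight Q y) =
      exp (w \<bullet> (matrix_inv Q *v w) / 2) * (LINT y|lborel. gaussian_weight Q y)"
  unfolding gaussian_weight_tilt[OF spd]
  by (simp_all add: int integrable_lborel_translate integral_lborel_translate)

text \<open>Uses exp |t| \<le> exp t + exp (-t). This supplies the majorants for dominated
  convergence and for the first moment.\<close>

lemma integrable_gaussian_abs_exp:
  fixes Q :: "real ^ 'n ^ 'n"
  assumes spd: "spd_matrix Q" and int: "integrable lborel (gaussian_weight Q)"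
  shows "integrable lborel (\<lambda>y. exp \<bar>w \<bullet> y\<bar> * gaussian_weight Q y)"
proof (rule Bochner_Integration.integrable_bound)
  show "integrable lborel (\<lambda>y. exp (w \<bullet> y) * gaussian_weight Q y + exp (- w \<bullet> y) * gaussian_weight Q y)"
    by (intro Bochner_Integration.integrable_add integrable_gaussian_tilt spd int)
  show "AE y in lborel. norm (exp \<bar>w \<bullet> y\<bar> * gaussian_weight Q y) \<le>
      norm (exp (w \<bullet> y) * gaussian_weight Q y + exp (- w \<bullet> y) * gaussian_weight Q y)"
    using less_imp_le[OF gaussian_weight_pos[of Q]]
    by (intro AE_I2) (auto simp: distrib_right[symmetric] abs_mult abs_of_pos add_pos_pos abs_if[of "w \<bullet> _"]
        intro!: mult_right_mono)
qed measurable

section \<open>Second-order behaviour of cosh and second moments\<close>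

lemma cosh_bounds:
  fixes s :: real
  shows "0 \<le> cosh s - 1" "cosh s - 1 \<le> s\<^sup>2 * exp \<bar>s\<bar>"
proof -
  have 1: "\<bar>sinh r\<bar> \<le> \<bar>r\<bar> * exp \<bar>r\<bar>" for r :: real
  proof -
    have "sinh r \<le> r * exp r" if "0 \<le> r" for r :: real
    proof -
      \<comment> \<open>Multiplied by exp r, this becomes exp r - exp (-r) \<le> 2 r exp r, which is
        the claim.\<close>
      have "(1 - 2 * r) \<le> exp (- 2 * r)"
        using exp_ge_add_one_self[of "- 2 * r"] by simp
      then have "(1 - 2 * r) * exp r \<le> exp (- 2 * r) * exp r"
        by (intro mult_right_mono) auto
      also have "\<dots> = exp (- r)"
        by (simp add: exp_add[symmetric])
      finally show ?thesis
        by (simp add: sinh_field_def field_simps)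
    qed
    from this[of "\<bar>r\<bar>"] show ?thesis
      by (cases "r \<ge> 0") (auto simp: abs_if)
  qed
  \<comment> \<open>The half-angle formula reduces the quadratic bound for cosh to the square of a
    linear bound for sinh.\<close>
  have eq: "cosh s - 1 = 2 * (sinh (s / 2))\<^sup>2"
    using cosh_double[of "s / 2"] cosh_square_eq[of "s / 2"] by simp
  show "0 \<le> cosh s - 1"
    by (simp add: eq)
  have "(sinh (s / 2))\<^sup>2 \<le> (\<bar>s / 2\<bar> * exp \<bar>s / 2\<bar>)\<^sup>2"
    using 1[of "s / 2"] by (metis abs_ge_zero power2_abs power_mono)
  also have "\<dots> = s\<^sup>2 / 4 * exp \<bar>s\<bar>"
    by (simp add: power_mult_distrib power_divide exp_double[symmetric])
  finally show "cosh s - 1 \<le> s\<^sup>2 * exp \<bar>s\<bar>"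
    by (simp add: eq) (smt (verit) exp_ge_zero zero_le_power2 mult_nonneg_nonneg)
qed

lemma tendsto_difference_quotient:
  fixes f :: "real \<Rightarrow> real"
  assumes "(f has_field_derivative D) (at 0)" "u \<longlonglongrightarrow> 0" "\<And>n. u n \<noteq> 0"
  shows "(\<lambda>n. (f (u n) - f 0) / u n) \<longlonglongrightarrow> D"
proof -
  have "((\<lambda>h. (f h - f 0) / h) \<longlongrightarrow> D) (at 0)"
    using assms(1) by (simp add: DERIV_def)
  moreover have "filterlim u (at 0) sequentially"
    using assms(2,3) by (simp add: filterlim_at)
  ultimately show ?thesis
    by (rule filterlim_compose)
qed

text \<open>By the half-angle formula the second-order quotient is twice the square of a difference
  quotient of sinh (h s / 2) at 0, so a first derivative suffices.\<close>

lemma tendsto_cosh_quotient: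
  fixes s :: real
  assumes "u \<longlonglongrightarrow> 0" "\<And>n. u n \<noteq> 0"
  shows "(\<lambda>n. (cosh (u n * s) - 1) / (u n)\<^sup>2) \<longlonglongrightarrow> s\<^sup>2 / 2"
proof -
  have "((\<lambda>h. sinh (h * s / 2)) has_field_derivative s / 2) (at 0)"
    by (auto intro!: derivative_eq_intros)
  from tendsto_power[OF tendsto_difference_quotient[OF this assms], of 2]
  have "(\<lambda>n. 2 * (sinh (u n * s / 2) / u n)\<^sup>2) \<longlonglongrightarrow> 2 * (s / 2)\<^sup>2"
    by (intro tendsto_mult_left) simp
  moreover have "2 * (sinh (u n * s / 2) / u n)\<^sup>2 = (cosh (u n * s) - 1) / (u n)\<^sup>2" for n
    using cosh_double[of "u n * s / 2"] cosh_square_eq[of "u n * s / 2"]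
    by (simp add: power_divide)
  moreover have "2 * (s / 2)\<^sup>2 = s\<^sup>2 / 2"
    by (simp add: power_divide)
  ultimately show ?thesis
    by (simp only:)
qed

text \<open>The second moments are read off the Laplace transform: symmetrised, its second difference
  quotient at \<open>0\<close> is the integral of \<open>(cosh (u * (w \<bullet> y)) - 1) / u\<^sup>2\<close>, which is dominated uniformly
  in \<open>0 < u \<le> 1\<close>.\<close>

lemma
  fixes Q :: "real ^ 'n ^ 'n"
  assumes spd: "spd_matrix Q" and int: "integrable lborel (gaussian_weight Q)"
  shows integrable_gaussian_square: "integrable lborel (\<lambda>y. (w \<bullet> y)\<^sup>2 * gaussian_weight Q y)" (is ?I)
    and integral_gaussian_square: "(LINT y|lborel. (w \<bullet> y)\<^sup>2 * gaussian_weight Q y) =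
      w \<bullet> (matrix_inv Q *v w) * (LINT y|lborel. gaussian_weight Q y)" (is ?E)
proof -
  \<comment> \<open>The shift by one keeps \<open>u n\<close> finite at \<open>n = 0\<close>, and
    \<open>u n \<le> 1\<close> makes the majorant independent of \<open>n\<close>.\<close>
  define u where "u n = 1 / real (Suc n)" for n
  define Z v where "Z = (LINT y|lborel. gaussian_weight Q y)" and "v = w \<bullet> (matrix_inv Q *v w)"
  have u: "u \<longlonglongrightarrow> 0" "\<And>n. 0 < u n" "\<And>n. u n \<le> 1"
    using LIMSEQ_inverse_real_of_nat by (auto simp: u_def[abs_def] inverse_eq_divide)
  have u0: "u n \<noteq> 0" for n
    using u(2)[of n] by simp
  let ?f = "\<lambda>n y. (cosh (u n * (w \<bullet> y)) - 1) / (u n)\<^sup>2 * gaussian_weight Q y"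
  let ?g = "\<lambda>y. (w \<bullet> y)\<^sup>2 / 2 * gaussian_weight Q y"
  \<comment> \<open>The doubled vector absorbs the polynomial factor: s^2 \<le> 2 exp |s|, and exp
    |s| * exp |s| = exp |2 s|.\<close>
  let ?b = "\<lambda>y. 2 * (exp \<bar>(2 *\<^sub>R w) \<bullet> y\<bar> * gaussian_weight Q y)"
  have meas [measurable]: "?f n \<in> borel_measurable lborel" for n
    unfolding cosh_field_def by measurable
  have b: "integrable lborel ?b"
    by (intro integrable_mult_right integrable_gaussian_abs_exp spd int)
  have lim: "AE y in lborel. (\<lambda>n. ?f n y) \<longlonglongrightarrow> ?g y"
    by (intro AE_I2 tendsto_mult tendsto_const tendsto_cosh_quotient u u0)
  have bound: "AE y in lborel. norm (?f n y) \<le> ?b y" for n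
  proof (rule AE_I2)
    fix y
    define s where "s = w \<bullet> y"
    have "cosh (u n * s) - 1 \<le> (u n * s)\<^sup>2 * exp \<bar>u n * s\<bar>"
      by (rule cosh_bounds)
    also have "\<dots> \<le> (u n)\<^sup>2 * (s\<^sup>2 * exp \<bar>s\<bar>)"
      using u(2)[of n] u(3)[of n] by (simp add: power_mult_distrib abs_mult mult_left_mono mult_left_le_one_le)
    finally have "(cosh (u n * s) - 1) / (u n)\<^sup>2 \<le> s\<^sup>2 * exp \<bar>s\<bar>"
      using u(2)[of n] by (simp add: field_simps)
    also have "\<dots> \<le> (2 * exp \<bar>s\<bar>) * exp \<bar>s\<bar>"
      using exp_lower_Taylor_quadratic[of "\<bar>s\<bar>"] by (intro mult_right_mono) auto
    also have "\<dots> = 2 * exp \<bar>2 * s\<bar>"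
      by (simp add: exp_add[symmetric])
    finally have "(cosh (u n * s) - 1) / (u n)\<^sup>2 \<le> 2 * exp \<bar>2 * s\<bar>" .
    then have "(cosh (u n * s) - 1) / (u n)\<^sup>2 * gaussian_weight Q y \<le> 2 * exp \<bar>2 * s\<bar> * gaussian_weight Q y"
      using gaussian_weight_pos[of Q y] by (intro mult_right_mono) auto
    then show "norm (?f n y) \<le> ?b y"
      using cosh_bounds(1)[of "u n * s"] gaussian_weight_pos[of Q y] by (simp add: s_def abs_mult)
  qed
  note dct = _ _ b lim bound
  have "integrable lborel ?g"
    by (rule integrable_dominated_convergence[OF dct]) measurable
  then show ?I
    using integrable_mult_right[of 2 lborel ?g] by simp
  have "(\<lambda>n. LINT y|lborel. ?f n y) \<longlonglongrightarrow> (LINT y|lborel. ?g y)"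
    by (rule integral_dominated_convergence[OF dct]) measurable
  \<comment> \<open>The Laplace transform evaluates the same integrals in closed form, where
    \<open>u n\<close> enters only through its square. The limit is thus a first derivative along
    the step \<open>(u n)^2\<close>.\<close>
  moreover have "(\<lambda>n. LINT y|lborel. ?f n y) \<longlonglongrightarrow> v / 2 * Z"
  proof -
    have "((\<lambda>h. exp (h * v / 2)) has_field_derivative v / 2) (at 0)"
      by (auto intro!: derivative_eq_intros)
    moreover have "(\<lambda>n. (u n)\<^sup>2) \<longlonglongrightarrow> 0"
      using tendsto_power[OF u(1), of 2] by simp
    ultimately have "(\<lambda>n. (exp ((u n)\<^sup>2 * v / 2) - 1) / (u n)\<^sup>2) \<longlonglongrightarrow> v / 2"
      using tendsto_difference_quotient[of _ _ "\<lambda>n. (u n)\<^sup>2"] u0 by fastforce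
    then have "(\<lambda>n. (exp ((u n)\<^sup>2 * v / 2) - 1) / (u n)\<^sup>2 * Z) \<longlonglongrightarrow> v / 2 * Z"
      by (rule tendsto_mult_right)
    moreover have "(LINT y|lborel. ?f n y) = (exp ((u n)\<^sup>2 * v / 2) - 1) / (u n)\<^sup>2 * Z" for n
    proof -
      define F where "F c y = exp ((c *\<^sub>R w) \<bullet> y) * gaussian_weight Q y" for c y
      \<comment> \<open>The two exponentials in cosh are tilts in opposite directions, with equal
        Laplace values because the exponent is even in \<open>c\<close>.\<close>
      have eq: "?f n y = (F (u n) y / 2 + F (- u n) y / 2 - gaussian_weight Q y) / (u n)\<^sup>2" for y
        by (simp add: F_def cosh_field_def field_simps)
      have F: "integrable lborel (F c)" "(LINT y|lborel. F c y) = exp (c\<^sup>2 * v / 2) * Z" for c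
        using integrable_gaussian_tilt[OF spd int, of "c *\<^sub>R w"] integral_gaussian_tilt[OF spd int, of "c *\<^sub>R w"]
        by (simp_all add: F_def[abs_def] v_def Z_def power2_eq_square matrix_vector_mult_scaleR mult.assoc)
      show ?thesis
        unfolding eq by (simp add: F int Z_def[symmetric]) (simp add: left_diff_distrib)
    qed
    ultimately show ?thesis
      by (simp only:)
  qed
  ultimately have "(LINT y|lborel. ?g y) = v / 2 * Z"
    by (rule LIMSEQ_unique)
  then show ?E
    by (simp add: v_def Z_def)
qed

text \<open>Polarization of the square formula; symmetry of \<open>matrix_inv Q\<close> merges the
  two cross terms.\<close>

lemma integral_gaussian_bilinear:
  fixes Q :: "real ^ 'n ^ 'n"
  assumes spd: "spd_matrix Q" and int: "integrable lborel (gaussian_weight Q)"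
  shows "(LINT y|lborel. (a \<bullet> y) * (b \<bullet> y) * gaussian_weight Q y) =
    a \<bullet> (matrix_inv Q *v b) * (LINT y|lborel. gaussian_weight Q y)"
proof -
  let ?s = "\<lambda>w y. (w \<bullet> y)\<^sup>2 * gaussian_weight Q y"
  have "(a \<bullet> y) * (b \<bullet> y) * gaussian_weight Q y = (?s (a + b) y - ?s a y - ?s b y) / 2" for y
    by (simp add: power2_eq_square inner_add_left field_simps)
  then have "(LINT y|lborel. (a \<bullet> y) * (b \<bullet> y) * gaussian_weight Q y) =
      (LINT y|lborel. (?s (a + b) y - ?s a y - ?s b y) / 2)"
    by presburger
  also have "\<dots> = a \<bullet> (matrix_inv Q *v b) * (LINT y|lborel. gaussian_weight Q y)"
    using spd_matrix_inner_commute[OF spd_matrix_inverse[OF spd], of a b]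
    by (simp add: integrable_gaussian_square[OF assms] integral_gaussian_square[OF assms])
       (simp add: inner_add_left inner_add_right matrix_vector_right_distrib field_simps)
  finally show ?thesis .
qed

section \<open>Mean and covariance of a Gaussian density\<close>

text \<open>The norm is at most the sum of the absolute coordinates, each bounded by an exponential
  via |t| \<le> exp |t|. It allows the shift \<open>\<mu>\<close> to be split off when the mean is
  computed.\<close>

lemma integrable_gaussian_vector:
  fixes Q :: "real ^ 'n ^ 'n"
  assumes spd: "spd_matrix Q" and int: "integrable lborel (gaussian_weight Q)"
  shows "integrable lborel (\<lambda>y. gaussian_weight Q y *\<^sub>R y)"
proof (rule Bochner_Integration.integrable_bound)
  show "integrable lborel (\<lambda>y. \<Sum>b\<in>Basis. exp \<bar>b \<bullet> y\<bar> * gaussian_weight Q y)"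
    by (intro Bochner_Integration.integrable_sum integrable_gaussian_abs_exp spd int)
  have "norm (gaussian_weight Q y *\<^sub>R y) \<le> norm (\<Sum>b\<in>Basis. exp \<bar>b \<bullet> y\<bar> * gaussian_weight Q y)" for y
  proof -
    have "norm y \<le> (\<Sum>b\<in>Basis. \<bar>y \<bullet> b\<bar>)"
      by (rule norm_le_l1)
    also have "\<dots> \<le> (\<Sum>b\<in>Basis. exp \<bar>b \<bullet> y\<bar>)"
    proof (rule sum_mono)
      show "\<bar>y \<bullet> b\<bar> \<le> exp \<bar>b \<bullet> y\<bar>" for b
        using exp_ge_add_one_self[of "\<bar>b \<bullet> y\<bar>"] unfolding inner_commute[of y b] by linarith
    qed
    finally have "gaussian_weight Q y * norm y \<le> (\<Sum>b\<in>Basis. exp \<bar>b \<bullet> y\<bar>) * gaussian_weight Q y"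
      using gaussian_weight_pos[of Q y] by (simp add: mult.commute)
    also have "\<dots> \<le> norm (\<Sum>b\<in>Basis. exp \<bar>b \<bullet> y\<bar> * gaussian_weight Q y)"
      by (simp add: sum_distrib_right)
    finally show ?thesis
      using gaussian_weight_pos[of Q y] by simp
  qed
  then show "AE y in lborel. norm (gaussian_weight Q y *\<^sub>R y) \<le>
      norm (\<Sum>b\<in>Basis. exp \<bar>b \<bullet> y\<bar> * gaussian_weight Q y)"
    by simp
qed measurable

lemma integral_gaussian_weight_pos:
  assumes "integrable lborel (gaussian_weight Q)"
  shows "0 < (LINT y|lborel. gaussian_weight Q y)"
proof -
  have "(LINT y|lborel. gaussian_weight Q y) \<noteq> 0"
  proof
    assume "(LINT y|lborel. gaussian_weight Q y) = 0"
    then have "AE y in lborel. gaussian_weight Q y = 0"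
      using integral_nonneg_eq_0_iff_AE[OF assms] gaussian_weight_pos[of Q] by (auto intro: less_imp_le)
    \<comment> \<open>Strict positivity turns vanishing into \<open>False\<close> almost everywhere,
      which would make the whole space a null set.\<close>
    then have "AE y in (lborel :: (real ^ 'a) measure). False"
      using gaussian_weight_pos[of Q] by (auto elim!: eventually_mono simp: less_le)
    then show False
      by (simp add: AE_iff_null null_sets_def)
  qed
  moreover have "0 \<le> (LINT y|lborel. gaussian_weight Q y)"
    using gaussian_weight_pos[of Q] by (simp add: less_imp_le)
  ultimately show ?thesis
    by simp
qed

text \<open>Recentring at \<open>\<mu>\<close> leaves the centred weight: its first moment vanishes
  by oddness, and its second moments along coordinate vectors are the entries of
  \<open>matrix_inv Q\<close> times the total mass.\<close>

lemma cov_matrix_gaussian_weight: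
  fixes Q :: "real ^ 'n ^ 'n"
  assumes spd: "spd_matrix Q" and int: "integrable lborel (gaussian_weight Q)"
  shows "cov_matrix (density lborel (\<lambda>y. ennreal
      (gaussian_weight Q (y - \<mu>) / (LINT z|lborel. gaussian_weight Q z)))) = matrix_inv Q"
proof -
  define Z where "Z = (LINT y|lborel. gaussian_weight Q y)"
  have Z: "0 < Z"
    unfolding Z_def by (rule integral_gaussian_weight_pos[OF int])
  let ?D = "density lborel (\<lambda>y. ennreal (gaussian_weight Q (y - \<mu>) / Z))"
  \<comment> \<open>Stated for Banach-valued \<open>h\<close>, as it serves both the vector-valued
    mean and the real covariance entries.\<close>
  have D: "(LINT y|?D. h (y - \<mu>)) = (LINT y|lborel. gaussian_weight Q y *\<^sub>R h y) /\<^sub>R Z"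
    if [measurable]: "h \<in> borel_measurable borel" for h :: "real ^ 'n \<Rightarrow> 'b::{banach, second_countable_topology}"
  proof -
    have "(LINT y|?D. h (y - \<mu>)) = (LINT y|lborel. (gaussian_weight Q (y - \<mu>) / Z) *\<^sub>R h (y - \<mu>))"
      using Z gaussian_weight_pos[of Q] by (intro integral_density) (auto intro!: AE_I2 divide_nonneg_pos intro: less_imp_le)
    also have "\<dots> = (LINT y|lborel. (gaussian_weight Q y / Z) *\<^sub>R h y)"
      by (rule integral_lborel_translate[of "\<lambda>y. (gaussian_weight Q y / Z) *\<^sub>R h y" \<mu>]) measurable
    also have "\<dots> = (LINT y|lborel. inverse Z *\<^sub>R (gaussian_weight Q y *\<^sub>R h y))"
      by (simp add: divide_inverse mult.commute)
    finally show ?thesis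
      by (simp only: integral_scaleR_right)
  qed
  have "(LINT y|?D. y) = (LINT y|?D. (\<lambda>y. y + \<mu>) (y - \<mu>))"
    by simp
  also have "\<dots> = (LINT y|lborel. gaussian_weight Q y *\<^sub>R (y + \<mu>)) /\<^sub>R Z"
    by (rule D) measurable
  also have "(LINT y|lborel. gaussian_weight Q y *\<^sub>R (y + \<mu>)) =
      (LINT y|lborel. gaussian_weight Q y *\<^sub>R y) + Z *\<^sub>R \<mu>"
    unfolding scaleR_add_right
    by (simp add: integrable_gaussian_vector[OF assms] int Z_def)
  also have "(LINT y|lborel. gaussian_weight Q y *\<^sub>R y) = 0"
    by (rule integral_lborel_odd) auto
  finally have mean: "(LINT y|?D. y) = \<mu>"
    using Z by simp
  have "(LINT y|?D. (y $ i - \<mu> $ i) * (y $ j - \<mu> $ j)) = matrix_inv Q $ i $ j" for i j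
  proof -
    have "(LINT y|?D. (y $ i - \<mu> $ i) * (y $ j - \<mu> $ j)) =
        (LINT y|?D. (\<lambda>y. (axis i 1 \<bullet> y) * (axis j 1 \<bullet> y)) (y - \<mu>))"
      by (simp add: inner_axis')
    also have "\<dots> = (LINT y|lborel. gaussian_weight Q y *\<^sub>R ((axis i 1 \<bullet> y) * (axis j 1 \<bullet> y))) /\<^sub>R Z"
      by (rule D) measurable
    also have "\<dots> = axis i 1 \<bullet> (matrix_inv Q *v axis j 1)"
      using integral_gaussian_bilinear[OF assms, of "axis i 1" "axis j 1"] Z
      by (simp add: Z_def mult.commute)
    finally show ?thesis
      by (simp add: inner_axis' matrix_vector_mult_basis column_def)
  qed
  then show ?thesis
    unfolding cov_matrix_def Z_def[symmetric] mean by (simp add: vec_eq_iff)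
qed

section \<open>Posterior covariance and its algebra\<close>

text \<open>All constant factors cancel in Bayes' rule, and \<open>a\<close> and \<open>m\<close>
  influence only the centre and those factors. What remains is a normalised weight whose precision
  is the sum of the two precisions.\<close>

lemma posterior_cov_gaussian:
  fixes A B :: "real ^ 'n ^ 'n"
  assumes A: "spd_matrix A" and B: "spd_matrix B" and int: "integrable lborel (gaussian_weight A)"
    and lik: "\<And>y. lik y = c * gaussian_weight B (a - y)"
    and prior: "\<And>y. prior y = d * gaussian_weight A (y - m)"
    and cd: "c \<noteq> 0" "d \<noteq> 0"
  shows "posterior_cov lik prior = matrix_inv (A + B)"
proof -
  obtain \<mu> k where k: "\<And>y. (y - m) \<bullet> (A *v (y - m)) + (a - y) \<bullet> (B *v (a - y)) =
      (y - \<mu>) \<bullet> ((A + B) *v (y - \<mu>)) + k"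
    using gaussian_product_exponent[OF A B] by blast
  define r where "r = c * d * exp (- k / 2)"
  have "gaussian_weight B (a - y) * gaussian_weight A (y - m) =
      exp (- k / 2) * gaussian_weight (A + B) (y - \<mu>)" for y
    unfolding gaussian_weight_def exp_add[symmetric] using k[of y] by simp
  then have "lik y * prior y = r * gaussian_weight (A + B) (y - \<mu>)" for y
    by (simp add: lik prior r_def)
  then have "posterior_density lik prior =
      (\<lambda>y. gaussian_weight (A + B) (y - \<mu>) / (LINT z|lborel. gaussian_weight (A + B) z))"
    using cd by (simp add: posterior_density_def[abs_def] integral_lborel_translate r_def)
  then show ?thesis
    unfolding posterior_cov_def
    using cov_matrix_gaussian_weight[OF spd_matrix_add[OF A B] integrable_gaussian_weight_add[OF B int]]
    by simp
qed

text \<open>With \<open>P = Cov\<close> and \<open>P\<^sup>-\<^sup>1 = \<SS>\<^sup>-\<^sup>1 + S\<^sup>-\<^sup>1\<close> one has \<open>S - P = S \<SS>\<^sup>-\<^sup>1 P\<close>, so everything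
  except \<open>\<SS>\<close> cancels.\<close>

lemma localized_covariance_eq:
  fixes \<SS> S :: "real ^ 'n ^ 'n"
  assumes "spd_matrix \<SS>" "spd_matrix S"
  defines "P \<equiv> matrix_inv (matrix_inv \<SS> + matrix_inv S)"
  shows "P ** matrix_inv (S - P) ** S = \<SS>"
proof -
  define Q where "Q = matrix_inv \<SS> + matrix_inv S"
  have "invertible Q"
    unfolding Q_def by (intro spd_matrix_invertible spd_matrix_add spd_matrix_inverse assms)
  then have QP: "Q ** P = mat 1" and PQ: "P ** Q = mat 1"
    by (simp_all add: P_def Q_def[symmetric] matrix_inv_left matrix_inv_right)
  have inv: "invertible \<SS>" "invertible S"
    using assms spd_matrix_invertible by auto
  \<comment> \<open>Expanding \<open>Q\<close> here produces a summand \<open>P\<close> that cancels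
    the subtracted one.\<close>
  have "S - P = S ** (Q ** P) - P"
    by (simp add: QP)
  also have "\<dots> = S ** (matrix_inv \<SS> ** P)"
    by (simp add: Q_def matrix_add_ldistrib matrix_mult_add_rdistrib matrix_mul_assoc matrix_inv_right inv)
  finally have SP: "S - P = S ** (matrix_inv \<SS> ** P)" .
  \<comment> \<open>The candidate inverse comes from inverting the three factors of
    \<open>S - P\<close> in reverse order.\<close>
  have "(S - P) ** (Q ** \<SS> ** matrix_inv S) =
      S ** matrix_inv \<SS> ** (P ** Q) ** \<SS> ** matrix_inv S"
    by (simp add: SP matrix_mul_assoc)
  also have "\<dots> = S ** (matrix_inv \<SS> ** \<SS>) ** matrix_inv S"
    by (simp add: PQ matrix_mul_assoc)
  also have "\<dots> = mat 1"
    by (simp add: matrix_inv_left matrix_inv_right inv)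
  finally have "matrix_inv (S - P) = Q ** \<SS> ** matrix_inv S"
    by (rule matrix_inv_eqI)
  then have "P ** matrix_inv (S - P) ** S = (P ** Q) ** \<SS> ** (matrix_inv S ** S)"
    by (simp add: matrix_mul_assoc)
  then show ?thesis
    by (simp add: PQ matrix_inv_left inv)
qed

theorem theorem3p1:
  fixes M :: "'w measure" and X :: "'w \<Rightarrow> real ^ 'n"
    and p\<^sub>X :: "real ^ 'n \<Rightarrow> real"
    and \<mm> :: "real ^ 'n" and \<SS> :: "real ^ 'n ^ 'n"
    and N :: nat and xs :: "nat \<Rightarrow> real ^ 'n" and S :: "nat \<Rightarrow> real ^ 'n ^ 'n"
    and C :: real and lik :: "nat \<Rightarrow> real ^ 'n \<Rightarrow> real"
    and Cov \<Sigma>t \<Sigma>h :: "nat \<Rightarrow> real ^ 'n ^ 'n"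
    and x :: "real ^ 'n"
  assumes "prob_space M"
    and "spd_matrix \<SS>"
    and "p\<^sub>X = gaussian_density \<mm> \<SS>"
    and "distributed M lborel X (\<lambda>y. ennreal (p\<^sub>X y))"
    and "N \<ge> 1"
    and "\<And>i. i \<in> {1..N} \<Longrightarrow> spd_matrix (S i)"
    and "C > 0"
    and "\<And>i y. i \<in> {1..N} \<Longrightarrow>
           lik i y = C / sqrt (det (S i)) *
             exp (- 1 / 2 * ((xs i - y) \<bullet> (matrix_inv (S i) *v (xs i - y))))"
    and "\<And>i. i \<in> {1..N} \<Longrightarrow> Cov i = posterior_cov (lik i) p\<^sub>X"
    and "\<And>i. i \<in> {1..N} \<Longrightarrow> \<Sigma>t i = Cov i ** matrix_inv (S i - Cov i) ** S i"
    and "\<And>i. i \<in> {1..N} \<Longrightarrow> \<Sigma>h i = bandwidth_sq N CARD('n) *\<^sub>R \<Sigma>t i"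
  shows "gaussian_kde N xs \<Sigma>h x = gaussian_kde N xs (\<lambda>i. bandwidth_sq N CARD('n) *\<^sub>R \<SS>) x"
proof -
  let ?A = "matrix_inv \<SS>"
  let ?d = "(2 * pi) powr (- real CARD('n) / 2) * (det \<SS>) powr (- 1 / 2)"
  have A: "spd_matrix ?A"
    by (rule spd_matrix_inverse[OF assms(2)])
  have d: "?d \<noteq> 0"
    using spd_matrix_invertible[OF assms(2)] by (simp add: invertible_det_nz)
  have prior: "p\<^sub>X y = ?d * gaussian_weight ?A (y - \<mm>)" for y
    by (simp add: assms(3) gaussian_density_def gaussian_kernel_def gaussian_weight_def)
  have nonneg: "0 \<le> p\<^sub>X y" for y
    using gaussian_weight_pos[of ?A "y - \<mm>"] by (simp add: prior)
  interpret prob_space M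
    by fact
  \<comment> \<open>The constant 1 is integrable on the probability space, hence so is the density
    of \<open>X\<close>; undoing the scaling by \<open>?d\<close> and the translation by
    \<open>\<mm>\<close> passes this to the weight.\<close>
  have "integrable lborel (\<lambda>y. p\<^sub>X y * 1)"
    using distributed_integrable[OF assms(4), of "\<lambda>_. 1 :: real"] nonneg by simp
  then have int: "integrable lborel (gaussian_weight ?A)"
    using d by (simp add: prior integrable_lborel_translate)
  \<comment> \<open>The two estimates agree kernel by kernel, since the matrices coincide for every
    index.\<close>
  have "\<Sigma>h i = bandwidth_sq N CARD('n) *\<^sub>R \<SS>" if i: "i \<in> {1..N}" for i
  proof -
    note S = assms(6)[OF i]
    have c: "C / sqrt (det (S i)) \<noteq> 0"
      using assms(7) spd_matrix_invertible[OF S] by (simp add: invertible_det_nz)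
    have "Cov i = matrix_inv (?A + matrix_inv (S i))"
      unfolding assms(9)[OF i]
      by (rule posterior_cov_gaussian[where a = "xs i", OF A spd_matrix_inverse[OF S] int _ prior c d])
         (simp add: assms(8)[OF i] gaussian_weight_def)
    then show ?thesis
      using assms(10,11)[OF i] localized_covariance_eq[OF assms(2) S] by simp
  qed
  then show ?thesis
    unfolding gaussian_kde_def by (intro arg_cong[where f = "\<lambda>t. 1 / real N * t"] sum.cong) auto
qed

end
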